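(* For all integers $k \ge 1$ it holds that $S_2(k) \le \mathrm{nM}(k) \le k + 1 + \lfloor \log_2(k) \rfloor$.
   Context: For $k \ge 1$, $S_2(k)$ denotes the smallest integer $n \ge 0$ such that $2^k$ divides $n!$. The non-Mersenne numbers: $\mathrm{nM} : \mathbb{N} \to \mathbb{N}$ (with $\mathbb{N} = \{1,2,\dots\}$) is the strictly increasing enumeration of the natural numbers $\ge 1$ that are not of the form $2^n - 1$ for some $n \in \mathbb{N}$; thus $\mathrm{nM}(1), \mathrm{nM}(2), \dots$ is $2,4,5,6,8,9,10,11,12,13,14,16,17,\dots$. *)

theory Defs
  imports Complex_Main "HOL-Library.Infinite_Set"
begin

definition S2 :: "nat \<Rightarrow> nat" where
  "S2 k = (LEAST n. 2 ^ k dvd (fact n :: nat))"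

text \<open>
  The subtraction on natural numbers never truncates, since \<open>2 ^ n \<ge> 1\<close>.
\<close>

definition non_Mersenne :: "nat set" where
  "non_Mersenne = {m. 1 \<le> m \<and> \<not> (\<exists>n\<ge>1. m = 2 ^ n - 1)}"

text \<open>
  \<^const>\<open>enumerate\<close> counts from \<open>0\<close>, whereas \<open>nM\<close> counts from \<open>1\<close>. The value
  \<open>nM 0\<close> is irrelevant.
\<close>

definition nM :: "nat \<Rightarrow> nat" where
  "nM k = enumerate non_Mersenne (k - 1)"

lemma S2_dvd: "2 ^ k dvd (fact (S2 k) :: nat)"
proof -
  have "(2::nat) ^ k dvd fact (2 ^ k)"
    by (rule dvd_fact) simp_all
  then show ?thesis
    unfolding S2_def by (rule LeastI)
qed

lemma infinite_non_Mersenne: "infinite non_Mersenne"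
proof -
  have "2 * Suc m \<in> non_Mersenne" for m
  proof -
    have "2 * Suc m \<noteq> 2 ^ n - 1" if "n \<ge> 1" for n :: nat
    proof
      assume "2 * Suc m = 2 ^ n - 1"
      then have "Suc (2 * Suc m) = 2 ^ n"
        by simp
      moreover have "even ((2::nat) ^ n)"
        using that by simp
      moreover have "odd (Suc (2 * Suc m))"
        by simp
      ultimately show False
        by metis
    qed
    then show ?thesis
      by (auto simp: non_Mersenne_def)
  qed
  then have "range (\<lambda>m. 2 * Suc m) \<subseteq> non_Mersenne"
    by blast
  moreover have "infinite (range (\<lambda>m::nat. 2 * Suc m))"
    by (rule range_inj_infinite) (simp add: inj_on_def)
  ultimately show ?thesis
    using infinite_super by blast
qed

lemma strict_mono_on_nM: "strict_mono_on {1..} nM"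
  by (auto simp: strict_mono_on_def nM_def
      intro!: enumerate_mono infinite_non_Mersenne)

lemma nM_image: "nM ` {1..} = non_Mersenne"
proof -
  have "(\<lambda>k::nat. k - 1) ` {1..} = UNIV"
    by (auto simp: image_iff intro!: bexI[of _ "Suc _"])
  then have "nM ` {1..} = range (enumerate non_Mersenne)"
    unfolding nM_def by (metis image_image)
  then show ?thesis
    using range_enumerate[OF infinite_non_Mersenne] by simp
qed

end

theory Submission
  imports Defs
begin

text \<open>
  If \<open>m\<close> is non-Mersenne and \<open>2 ^ L \<le> m < 2 ^ (L + 1) - 1\<close>, the Mersenne numbers below \<open>m\<close> are
  those with exponents \<open>1, \<dots>, L\<close>, so \<open>m = nM k\<close> exactly when \<open>m = k + L\<close>. By Legendre's formula
  the 2-adic valuation of \<open>m!\<close> is \<open>m\<close> minus the binary digit sum of \<open>m\<close>; as not all of the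
  \<open>L + 1\<close> digits are ones, \<open>2 ^ k\<close> divides \<open>m!\<close>. The upper bound is \<open>k \<ge> 2 ^ L - L \<ge> 2 ^ (L - 1)\<close>.
\<close>

text \<open>The even factors of \<open>fact (2 * n)\<close> alone have product
  \<open>2 ^ n * fact n\<close>.\<close>

lemma power_two_mult_fact_dvd_fact_double: "2 ^ n * fact n dvd (fact (2 * n) :: nat)"
proof (induction n)
  case (Suc n)
  have "(2::nat) ^ Suc n * fact (Suc n) = (2 * Suc n) * (2 ^ n * fact n)"
    by (simp add: algebra_simps)
  also have "\<dots> dvd (2 * Suc n) * (fact (2 * n) * (2 * n + 1))"
    using Suc.IH by (intro mult_dvd_mono dvd_mult2 dvd_refl)
  also have "\<dots> = fact (2 * Suc n)"
    by (simp add: algebra_simps)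
  finally show ?case .
qed simp

text \<open>
  The hypothesis says that \<open>m\<close> has at most \<open>j + 1\<close> binary digits, not all of them ones, whence its
  digit sum is at most \<open>j\<close>.
\<close>

lemma power_two_dvd_mult_fact:
  assumes "m + 1 < 2 ^ (j + 1)"
  shows "(2::nat) ^ m dvd 2 ^ j * fact m"
  using assms
proof (induction j arbitrary: m)
  case (Suc j)
  define q where "q = m div 2"
  \<comment> \<open>Appending a binary digit 0 to \<open>q\<close> keeps the digit sum, so the same
    \<open>b\<close> serves for \<open>2 * q\<close>.\<close>
  have double: "(2::nat) ^ (a + q) dvd 2 ^ b * fact (2 * q)"
    if "(2::nat) ^ a dvd 2 ^ b * fact q" for a b :: nat
  proof -
    have "(2::nat) ^ (a + q) dvd (2 ^ b * fact q) * 2 ^ q"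
      unfolding power_add using that by (rule mult_dvd_mono) simp
    also have "\<dots> = 2 ^ b * (2 ^ q * fact q)"
      by simp
    also have "\<dots> dvd 2 ^ b * fact (2 * q)"
      by (intro mult_dvd_mono dvd_refl power_two_mult_fact_dvd_fact_double)
    finally show ?thesis .
  qed
  show ?case
  proof (cases "even m")
    case True
    then have m: "m = 2 * q"
      by (simp add: q_def)
    \<comment> \<open>Here \<open>q\<close> may consist of \<open>j + 1\<close> ones, so the
      induction hypothesis is applied to its predecessor \<open>p\<close>; the additional factor 2
      in \<open>2 ^ Suc j\<close> makes up for the difference.\<close>
    have "(2::nat) ^ q dvd 2 ^ Suc j * fact q"
    proof (cases q)
      case (Suc p)
      have "p + 1 < 2 ^ (j + 1)"
        using Suc.prems m Suc by simp
      then have "(2::nat) ^ p dvd 2 ^ j * fact p"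
        by (rule Suc.IH)
      then have "(2::nat) * 2 ^ p dvd 2 * ((2 ^ j * fact p) * q)"
        by (rule mult_dvd_mono[OF dvd_refl dvd_mult2])
      also have "2 * ((2 ^ j * fact p) * q) = 2 ^ Suc j * fact q"
        by (simp add: Suc algebra_simps)
      finally show ?thesis
        by (simp add: Suc)
    qed simp
    from double[OF this] show ?thesis
      by (simp add: m mult_2)
  next
    case False
    then have m: "m = 2 * q + 1"
      by (simp add: q_def)
    \<comment> \<open>The last digit 1 of \<open>m\<close> will use up the additional factor 2. The
      remaining digits are still not all ones, so the induction hypothesis applies to
      \<open>q\<close> itself.\<close>
    have "q + 1 < 2 ^ (j + 1)"
      using Suc.prems m by simp
    then have "(2::nat) ^ (q + q) dvd 2 ^ j * fact (2 * q)"
      by (intro double Suc.IH)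
    also have "\<dots> dvd 2 ^ j * fact m"
      by (intro mult_dvd_mono dvd_refl fact_dvd) (simp add: m)
    finally have "2 * (2::nat) ^ (q + q) dvd 2 * (2 ^ j * fact m)"
      by (rule mult_dvd_mono[OF dvd_refl])
    then have "(2::nat) ^ Suc (q + q) dvd 2 ^ Suc j * fact m"
      by (simp only: power_Suc mult.assoc)
    moreover have "Suc (q + q) = m"
      using m by simp
    ultimately show ?thesis
      by (simp only:)
  qed
qed simp

lemma card_less_enumerate:
  fixes S :: "nat set"
  assumes "infinite S"
  shows "card {x \<in> S. x < enumerate S n} = n"
proof -
  have "{x \<in> S. x < enumerate S n} = enumerate S ` {..<n}"
  proof (intro equalityI subsetI)
    fix x
    assume x: "x \<in> {x \<in> S. x < enumerate S n}"
    then obtain i where "x = enumerate S i"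
      using range_enumerate[OF assms] by blast
    with x assms show "x \<in> enumerate S ` {..<n}"
      by auto
  qed (use assms enumerate_in_set in auto)
  then show ?thesis
    using card_image[OF inj_on_subset[OF inj_enumerate[OF assms] subset_UNIV]] by simp
qed

text \<open>Below \<open>nM k\<close> lie \<open>k - 1\<close> non-Mersenne numbers and, with
  \<open>L\<close> as chosen, the \<open>L\<close> Mersenne numbers with exponents 1 to
  \<open>L\<close>; together they exhaust the \<open>nM k - 1\<close> positive integers
  there.\<close>

lemma nM_eq_add:
  assumes "k \<ge> 1"
  obtains L where "L \<ge> 1" "nM k = k + L" "2 ^ L \<le> nM k" "nM k + 1 < 2 ^ (L + 1)"
proof -
  define m where "m = nM k"
  have m: "1 \<le> m" "m \<noteq> 2 ^ n - 1" if "n \<ge> 1" for n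
    using nM_image assms that unfolding m_def non_Mersenne_def by auto
  \<comment> \<open>Bracketing \<open>m + 1\<close> instead of \<open>m\<close> makes Mersenne
    numbers the end points; the lower one is excluded since \<open>m\<close> is not
    Mersenne.\<close>
  obtain L where L: "2 ^ L \<le> m + 1" "m + 1 < 2 ^ (L + 1)"
    using ex_power_ivl1[of 2 "m + 1"] by auto
  have "L \<noteq> 0"
    using L m(1)[of 1] by (intro notI) simp
  then have "2 ^ L \<le> m"
    using L(1) m(2)[of L] by linarith
  have "{1..<m} = {x \<in> non_Mersenne. x < m} \<union> (\<lambda>n. 2 ^ n - 1) ` {1..L}" (is "_ = ?A \<union> ?B")
  proof (intro equalityI subsetI)
    fix x
    assume x: "x \<in> {1..<m}"
    show "x \<in> ?A \<union> ?B"
    proof (cases "x \<in> non_Mersenne")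
      case False
      with x obtain n where n: "n \<ge> 1" "x = 2 ^ n - 1"
        by (auto simp: non_Mersenne_def)
      then have "(2::nat) ^ n < 2 ^ (L + 1)"
        using x L(2) unfolding atLeastLessThan_iff by linarith
      then have "n \<le> L"
        by (simp del: power_Suc add_2_eq_Suc')
      with n show ?thesis
        by auto
    qed (use x in simp)
  next
    fix x
    assume "x \<in> ?A \<union> ?B"
    then show "x \<in> {1..<m}"
    proof
      assume "x \<in> ?B"
      then obtain n where n: "1 \<le> n" "n \<le> L" "x = 2 ^ n - 1"
        by auto
      then have "(2::nat) ^ 1 \<le> 2 ^ n" "(2::nat) ^ n \<le> 2 ^ L"
        by (intro power_increasing; simp)+
      with n(3) \<open>2 ^ L \<le> m\<close> show ?thesis
        unfolding atLeastLessThan_iff power_one_right by linarith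
    qed (auto simp: non_Mersenne_def)
  qed
  moreover have "?A \<inter> ?B = {}"
    by (auto simp: non_Mersenne_def)
  moreover have "finite ?A"
    by simp
  ultimately have "card {1..<m} = card ?A + card ?B"
    by (simp add: card_Un_disjoint)
  moreover have "card ?A = k - 1"
    unfolding m_def nM_def by (rule card_less_enumerate[OF infinite_non_Mersenne])
  moreover have "card ?B = L"
  proof -
    have "inj_on (\<lambda>n. 2 ^ n - 1 :: nat) {1..L}"
      by (rule inj_onI) (simp add: eq_diff_iff)
    then show ?thesis
      by (simp add: card_image)
  qed
  ultimately have "m = k + L"
    using assms m(1)[of 1] by simp
  with L \<open>L \<noteq> 0\<close> \<open>2 ^ L \<le> m\<close> show thesis
    by (intro that) (simp_all add: m_def)
qed

theorem theorem6p1: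
  fixes k :: nat
  assumes "k \<ge> 1"
  shows "S2 k \<le> nM k \<and> int (nM k) \<le> int k + 1 + \<lfloor>log 2 (real k)\<rfloor>"
proof -
  obtain L where L: "L \<ge> 1" "nM k = k + L" "2 ^ L \<le> nM k" "nM k + 1 < 2 ^ (L + 1)"
    using nM_eq_add[OF assms] .
  \<comment> \<open>The deficit \<open>2 ^ L\<close> from the digit sum is exactly the surplus of
    \<open>nM k\<close> over \<open>k\<close>, so it cancels.\<close>
  have "(2::nat) ^ L * 2 ^ k dvd 2 ^ L * fact (nM k)"
    using power_two_dvd_mult_fact[OF L(4)] by (simp add: L(2) power_add mult.commute)
  then have "2 ^ k dvd (fact (nM k) :: nat)"
    by (simp only: nat_mult_dvd_cancel_disj) simp
  then have "S2 k \<le> nM k"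
    unfolding S2_def by (rule Least_le)
  moreover
  \<comment> \<open>Since \<open>k + L = k + 1 + l\<close>, the upper bound reduces to
    \<open>2 ^ l \<le> k\<close>.\<close>
  obtain l where l: "L = Suc l"
    using L(1) by (cases L) auto
  have "Suc l \<le> 2 ^ l"
    using less_exp[of l] by (rule Suc_leI)
  then have "2 ^ l \<le> k"
    using L(2,3) by (simp add: l)
  then have "2 ^ l \<le> real k"
    by (metis of_nat_le_iff of_nat_numeral of_nat_power)
  then have "real l \<le> log 2 (real k)"
    by (simp add: le_log_of_power)
  then have "int l \<le> \<lfloor>log 2 (real k)\<rfloor>"
    by (simp add: le_floor_iff)
  then have "int (nM k) \<le> int k + 1 + \<lfloor>log 2 (real k)\<rfloor>"
    by (simp add: L(2) l)
  ultimately show ?thesis ..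
qed

end
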